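(* Let $(E,w)$ be a weighted graph. Suppose there exists $u\in E^0$ which emits edges of exactly two distinct weights $\alpha<\beta$ and such that $u\notin r(s^{-1}(u))$. Write $\beta=m\alpha+\delta$ with $m\ge 1$ and $0\le\delta<\alpha$, and assume that for every $s\in\operatorname{supp}_0(\Sigma_\alpha(u))\cup\operatorname{supp}_0(\Sigma_\beta(u))$, $$\mu(s)>\begin{cases}\max\{c_s(\Sigma_\alpha(u)),\,c_s(\Sigma_\beta(u))\} & \text{if } m=1,\\ \max\{c_s(\Sigma_\alpha(u))+c_s(\Sigma_\beta(u)),\ m\,c_s(\Sigma_\alpha(u))\} & \text{otherwise.}\end{cases}$$ Then the weighted graph monoid $\mathcal M(E,w)$ is non-confluent.
   Context: $\mathbb N=\{1,2,\dots\}$. A directed graph is $E=(E^0,E^1,s,r)$ with vertex set $E^0$, edge set $E^1$ and source/range maps $s,r:E^1\to E^0$. A vertex $v$ is a sink if $s^{-1}(v)=\varnothing$ and regular if $0<|s^{-1}(v)|<\infty$. A weighted graph $(E,w)$ is a directed graph $E$ with a map $w:E^1\to\mathbb N$. Standing assumption: weighted graphs are nonempty, row-finite ($|s^{-1}(v)|<\infty$ for all $v$) and connected (the underlying undirected graph is connected). For $v\in E^0$ let $w_1(v)<\dots<w_{k_v}(v)$ be the distinct weights of the edges in $s^{-1}(v)$ (so $k_v=0$ for a sink), and put $w_0(v)=0$. Let $\mathcal E=\{v,q_1^v,\dots,q_{k_v-1}^v : v\in E^0\}$ (formal distinct symbols), let $F_{\mathcal E}$ be the free commutative monoid on $\mathcal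 E$, written additively, and set $q_0^v=q_{k_v}^v=0$ in $F_{\mathcal E}$. For regular $u$ and $\gamma\in w(s^{-1}(u))$ put $\Sigma_\gamma(u)=\sum_{e\in s^{-1}(u),\,w(e)=\gamma} r(e)\in F_{\mathcal E}$. Define the reduction relation $\to$ on $F_{\mathcal E}$ by $$y+q_{i-1}^u+(w_i(u)-w_{i-1}(u))u\ \to\ y+q_i^u+\Sigma_{w_i(u)}(u)$$ for all $y\in F_{\mathcal E}$, regular $u$ and $1\le i\le k_u$. Let $\to^*$ be its reflexive-transitive closure and $\sim$ the congruence it generates. The weighted graph monoid is $\mathcal M(E,w)=F_{\mathcal E}/\!\sim$. It is called confluent if for all $a,b\in F_{\mathcal E}$: $a\sim b$ if and only if there is $c\in F_{\mathcal E}$ with $a\to^* c$ and $b\to^* c$; otherwise non-confluent. For $s\in\mathcal E$ and $x\in F_{\mathcal E}$, $c_s(x)\in\mathbb N\cup\{0\}$ is the coefficient of $s$ in $x$, and $\operatorname{supp}_0(x)=\{s\in E^0 : c_s(x)\ne 0\}$. The map $\mu:E^0\to\mathbb N\cup\{\infty\}$ is $\mu(s)=\min\{w_i(s)-w_{i-1}(s) : 1\le i\le k_s\}$ if $s$ is regular, and $\mu(s)=\infty$ if $s$ is a sink. *)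

theory Defs
  imports
    "Graph_Theory.Digraph_Component"
    "HOL-Library.Multiset"
    "HOL-Library.Extended_Nat"
begin

text \<open>
  The source map \<open>s\<close> is \<^const>\<open>tail\<close>, the range map \<open>r\<close> is \<^const>\<open>head\<close>, and
  \<open>s\<^sup>-\<^sup>1(v)\<close> is \<^term>\<open>out_arcs G v\<close>.  The library's notion of connectedness entails that the
  vertex set is nonempty.
\<close>

locale weighted_graph = wf_digraph G for G :: "('v, 'e) pre_digraph" +
  fixes w :: "'e \<Rightarrow> nat"
  assumes weight_pos: "e \<in> arcs G \<Longrightarrow> 1 \<le> w e"
    and row_finite: "v \<in> verts G \<Longrightarrow> finite (out_arcs G v)"
    and connected: "connected G"

definition is_sink :: "('v, 'e) pre_digraph \<Rightarrow> 'v \<Rightarrow> bool" where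
  "is_sink G v \<longleftrightarrow> v \<in> verts G \<and> out_arcs G v = {}"

definition is_regular :: "('v, 'e) pre_digraph \<Rightarrow> 'v \<Rightarrow> bool" where
  "is_regular G v \<longleftrightarrow> v \<in> verts G \<and> out_arcs G v \<noteq> {} \<and> finite (out_arcs G v)"

definition num_weights :: "('v, 'e) pre_digraph \<Rightarrow> ('e \<Rightarrow> nat) \<Rightarrow> 'v \<Rightarrow> nat" where
  "num_weights G w v = card (w ` out_arcs G v)"

text \<open>
  \<open>nth_weight G w v i\<close> is \<open>w\<^sub>i(v)\<close>; the prefixed \<open>0\<close> realises the convention
  \<open>w\<^sub>0(v) = 0\<close>.  It is meaningful only for \<open>i \<le> num_weights G w v\<close>.
\<close>

definition nth_weight :: "('v, 'e) pre_digraph \<Rightarrow> ('e \<Rightarrow> nat) \<Rightarrow> 'v \<Rightarrow> nat \<Rightarrow> nat" where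
  "nth_weight G w v i = (0 # sorted_list_of_set (w ` out_arcs G v)) ! i"

text \<open>
  \<open>Vert v\<close> is the generator \<open>v\<close>, and \<open>Aux v i\<close> is the generator \<open>q\<^sub>i\<^sup>v\<close>.
  The free commutative monoid on the generators consists of the finite multisets of generators.
\<close>

datatype 'v gen = Vert 'v | Aux 'v nat

definition gens :: "('v, 'e) pre_digraph \<Rightarrow> ('e \<Rightarrow> nat) \<Rightarrow> 'v gen set" where
  "gens G w = Vert ` verts G \<union> {Aux v i | v i. v \<in> verts G \<and> 1 \<le> i \<and> i < num_weights G w v}"

definition free_comm_monoid :: "'a set \<Rightarrow> 'a multiset set" where
  "free_comm_monoid A = {x. set_mset x \<subseteq> A}"

definition q_elem :: "('v, 'e) pre_digraph \<Rightarrow> ('e \<Rightarrow> nat) \<Rightarrow> 'v \<Rightarrow> nat \<Rightarrow> 'v gen multiset" where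
  "q_elem G w v i = (if i = 0 \<or> i = num_weights G w v then {#} else {#Aux v i#})"

definition range_sum :: "('v, 'e) pre_digraph \<Rightarrow> ('e \<Rightarrow> nat) \<Rightarrow> nat \<Rightarrow> 'v \<Rightarrow> 'v gen multiset" where
  "range_sum G w \<gamma> u = (\<Sum>e\<in>{e \<in> out_arcs G u. w e = \<gamma>}. {#Vert (head G e)#})"

inductive reduction ::
  "('v, 'e) pre_digraph \<Rightarrow> ('e \<Rightarrow> nat) \<Rightarrow> 'v gen multiset \<Rightarrow> 'v gen multiset \<Rightarrow> bool"
  for G w where
  "\<lbrakk> y \<in> free_comm_monoid (gens G w); is_regular G u; 1 \<le> i; i \<le> num_weights G w u \<rbrakk> \<Longrightarrow>
    reduction G w
      (y + q_elem G w u (i - 1)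
         + replicate_mset (nth_weight G w u i - nth_weight G w u (i - 1)) (Vert u))
      (y + q_elem G w u i + range_sum G w (nth_weight G w u i) u)"

text \<open>The congruence on the free commutative monoid generated by the reduction relation;
  the weighted graph monoid is the quotient by it.\<close>

inductive wgm_cong ::
  "('v, 'e) pre_digraph \<Rightarrow> ('e \<Rightarrow> nat) \<Rightarrow> 'v gen multiset \<Rightarrow> 'v gen multiset \<Rightarrow> bool"
  for G w where
  base: "reduction G w x y \<Longrightarrow> wgm_cong G w x y"
| refl: "x \<in> free_comm_monoid (gens G w) \<Longrightarrow> wgm_cong G w x x"
| sym: "wgm_cong G w x y \<Longrightarrow> wgm_cong G w y x"
| trans: "wgm_cong G w x y \<Longrightarrow> wgm_cong G w y z \<Longrightarrow> wgm_cong G w x z"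
| add: "wgm_cong G w x y \<Longrightarrow> wgm_cong G w x' y' \<Longrightarrow> wgm_cong G w (x + x') (y + y')"

definition wgm_confluent :: "('v, 'e) pre_digraph \<Rightarrow> ('e \<Rightarrow> nat) \<Rightarrow> bool" where
  "wgm_confluent G w \<longleftrightarrow>
    (\<forall>a \<in> free_comm_monoid (gens G w). \<forall>b \<in> free_comm_monoid (gens G w).
      wgm_cong G w a b \<longleftrightarrow>
      (\<exists>c \<in> free_comm_monoid (gens G w). (reduction G w)\<^sup>*\<^sup>* a c \<and> (reduction G w)\<^sup>*\<^sup>* b c))"

definition supp0 :: "('v, 'e) pre_digraph \<Rightarrow> 'v gen multiset \<Rightarrow> 'v set" where
  "supp0 G x = {v \<in> verts G. count x (Vert v) \<noteq> 0}"

text \<open>In a weighted graph every vertex is regular or a sink.\<close>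

definition min_gap :: "('v, 'e) pre_digraph \<Rightarrow> ('e \<Rightarrow> nat) \<Rightarrow> 'v \<Rightarrow> enat" where
  "min_gap G w v =
    (if is_sink G v then \<infinity>
     else enat (Min {nth_weight G w v i - nth_weight G w v (i - 1) | i.
                      1 \<le> i \<and> i \<le> num_weights G w v}))"

end

theory Submission
  imports Defs
begin

text \<open>
  The proof exhibits one element with two different irreducible descendants.  Write \<open>q\<close> for
  the auxiliary generator at \<open>u\<close>, and \<open>A\<close>, \<open>B\<close> for \<open>\<Sigma>\<^sub>\<alpha>(u)\<close>, \<open>\<Sigma>\<^sub>\<beta>(u)\<close>.  The rules at \<open>u\<close> are
  \<open>\<alpha>u \<rightarrow> q + A\<close> and \<open>q + (\<beta> - \<alpha>)u \<rightarrow> B\<close>, and they compete on the element \<open>q + m\<alpha>u\<close>: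

    \<^item> Using only the first rule, \<open>m\<close> times, gives \<open>(m + 1)q + mA\<close>.

    \<^item> Since \<open>m\<alpha> = (\<beta> - \<alpha>) + (\<alpha> - \<delta>)\<close>, the second rule gives \<open>B + (\<alpha> - \<delta>)u\<close>.  If \<open>\<delta> = 0\<close>, then
      the first rule can still be applied once more and leads to \<open>A + B + q\<close>.

  A rule at a vertex \<open>s\<close> consumes at least \<open>\<mu>(s) \<ge> 1\<close> copies of \<open>s\<close>, so the bounds on \<open>\<mu>\<close>
  ensure that no rule at a vertex other than \<open>u\<close> applies to these results
  (\<open>irreducible_if_below_min_gap\<close>).  No rule at \<open>u\<close> applies either: \<open>u\<close> does not occur in
  \<open>A\<close> or \<open>B\<close>, so \<open>(m + 1)q + mA\<close> and \<open>A + B + q\<close> contain no \<open>u\<close> at all, while the \<open>\<alpha> - \<delta>\<close>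
  copies in \<open>B + (\<alpha> - \<delta>)u\<close> are too few for the first rule when \<open>\<delta> > 0\<close> and lack the \<open>q\<close>
  that the second one requires.  The first result contains \<open>q\<close> at least twice and the second at
  most once, so they differ.  Being congruent, distinct and irreducible, they refute confluence (\<open>not_confluent_if_two_normal_forms\<close>).
\<close>

section \<open>The free monoid and reductions\<close>

lemma free_comm_monoid_add [simp]:
  "x + y \<in> free_comm_monoid S \<longleftrightarrow> x \<in> free_comm_monoid S \<and> y \<in> free_comm_monoid S"
  by (auto simp: free_comm_monoid_def)

lemma replicate_Vert_in_free_comm_monoid:
  "v \<in> verts G \<Longrightarrow> replicate_mset n (Vert v) \<in> free_comm_monoid (gens G w)"
  by (auto simp: free_comm_monoid_def gens_def)

lemma q_elem_in_free_comm_monoid: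
  "v \<in> verts G \<Longrightarrow> i \<le> num_weights G w v \<Longrightarrow> q_elem G w v i \<in> free_comm_monoid (gens G w)"
  by (auto simp: q_elem_def free_comm_monoid_def gens_def)

lemma set_mset_range_sum:
  assumes "finite (out_arcs G v)"
  shows "set_mset (range_sum G w \<gamma> v) \<subseteq> Vert ` head G ` out_arcs G v"
proof -
  have fin: "finite {e \<in> out_arcs G v. w e = \<gamma>}"
    using assms by (rule rev_finite_subset) blast
  show ?thesis
    unfolding range_sum_def by (subst set_mset_sum[OF fin]) auto
qed

lemma range_sum_in_free_comm_monoid:
  assumes "wf_digraph G" "finite (out_arcs G v)"
  shows "range_sum G w \<gamma> v \<in> free_comm_monoid (gens G w)"
proof -
  interpret wf_digraph G by fact
  show ?thesis
    using set_mset_range_sum[OF assms(2), of w \<gamma>]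
    by (fastforce simp: free_comm_monoid_def gens_def)
qed

lemma reduction_in_free_comm_monoid:
  assumes "wf_digraph G" "reduction G w x y"
  shows "x \<in> free_comm_monoid (gens G w) \<and> y \<in> free_comm_monoid (gens G w)"
  using assms(2)
proof cases
  case (1 z v i)
  then show ?thesis
    using assms(1)
    by (auto simp: is_regular_def q_elem_in_free_comm_monoid
        replicate_Vert_in_free_comm_monoid range_sum_in_free_comm_monoid)
qed

lemma reductions_imp_cong:
  assumes "(reduction G w)\<^sup>*\<^sup>* x y" "x \<in> free_comm_monoid (gens G w)"
  shows "wgm_cong G w x y"
  using assms by induction (auto intro: wgm_cong.intros)

lemma irreducible_rtranclp_eq:
  assumes "r\<^sup>*\<^sup>* x y" "\<And>z. \<not> r x z"
  shows "y = x"
  using assms by (metis converse_rtranclpE)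

text \<open>
  Two descendants of one element are congruent, so confluence would give them a common
  descendant; an irreducible element has no descendant but itself.
\<close>

lemma not_confluent_if_two_normal_forms:
  assumes "wf_digraph G"
    and p: "p \<in> free_comm_monoid (gens G w)"
    and a: "(reduction G w)\<^sup>*\<^sup>* p a" "\<And>z. \<not> reduction G w a z"
    and b: "(reduction G w)\<^sup>*\<^sup>* p b" "\<And>z. \<not> reduction G w b z"
    and "a \<noteq> b"
  shows "\<not> wgm_confluent G w"
proof
  assume confl: "wgm_confluent G w"
  have in_F: "x \<in> free_comm_monoid (gens G w)" if "(reduction G w)\<^sup>*\<^sup>* p x" for x
    using that p reduction_in_free_comm_monoid[OF assms(1)] by induction auto
  have "wgm_cong G w a b"
    using reductions_imp_cong[OF a(1) p] reductions_imp_cong[OF b(1) p]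
    by (meson wgm_cong.sym wgm_cong.trans)
  then obtain c where "(reduction G w)\<^sup>*\<^sup>* a c" "(reduction G w)\<^sup>*\<^sup>* b c"
    using confl in_F[OF a(1)] in_F[OF b(1)] unfolding wgm_confluent_def by blast
  then have "c = a" "c = b"
    using irreducible_rtranclp_eq a(2) b(2) by metis+
  with \<open>a \<noteq> b\<close> show False by simp
qed

section \<open>Irreducibility below the minimal gap\<close>

text \<open>
  This makes every rule consume at least one copy of its vertex, so that a rule can only apply
  to elements in which its vertex occurs.
\<close>

lemma nth_weight_strict_mono:
  assumes "weighted_graph G w" "v \<in> verts G" "1 \<le> i" "i \<le> num_weights G w v"
  shows "nth_weight G w v (i - 1) < nth_weight G w v i"
proof -
  interpret weighted_graph G w by fact
  let ?W = "w ` out_arcs G v"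
  have fin: "finite ?W" using row_finite[OF assms(2)] by simp
  have "\<forall>x\<in>?W. 0 < x" using weight_pos by fastforce
  then have "sorted_wrt (<) (0 # sorted_list_of_set ?W)"
    using fin by (simp add: strict_sorted_list_of_set)
  moreover have "i - 1 < i" "i < length (0 # sorted_list_of_set ?W)"
    using assms(3,4) by (simp_all add: num_weights_def)
  ultimately show ?thesis
    unfolding nth_weight_def by (rule sorted_wrt_nth_less)
qed

lemma min_gap_le_gap:
  assumes "is_regular G v" "1 \<le> i" "i \<le> num_weights G w v"
  shows "min_gap G w v \<le> enat (nth_weight G w v i - nth_weight G w v (i - 1))"
  using assms by (auto simp: min_gap_def is_regular_def is_sink_def intro!: Min_le)

text \<open>
  The vertex \<open>u\<close> is exempt from the comparison with \<open>\<mu>\<close>: which of its rules can apply depends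
  on the auxiliary generators present, so an element may be irreducible at \<open>u\<close> although it
  contains \<open>\<mu>(u)\<close> or more copies of \<open>u\<close>.
\<close>

lemma irreducible_if_below_min_gap:
  assumes wg: "weighted_graph G w"
    and away: "\<And>v. v \<in> verts G \<Longrightarrow> v \<noteq> u \<Longrightarrow> 0 < count x (Vert v) \<Longrightarrow>
      enat (count x (Vert v)) < min_gap G w v"
    and at_u: "\<And>i. 1 \<le> i \<Longrightarrow> i \<le> num_weights G w u \<Longrightarrow> q_elem G w u (i - 1) \<subseteq># x \<Longrightarrow>
      count x (Vert u) < nth_weight G w u i - nth_weight G w u (i - 1)"
  shows "\<not> reduction G w x y"
proof
  assume "reduction G w x y"
  then obtain z v i where
    x: "x = z + q_elem G w v (i - 1)
         + replicate_mset (nth_weight G w v i - nth_weight G w v (i - 1)) (Vert v)"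
    and v: "is_regular G v" and i: "1 \<le> i" "i \<le> num_weights G w v"
    by cases auto
  have "v \<in> verts G" using v by (simp add: is_regular_def)
  then have gap_pos: "0 < nth_weight G w v i - nth_weight G w v (i - 1)"
    using nth_weight_strict_mono[OF wg] i by simp
  have enough: "nth_weight G w v i - nth_weight G w v (i - 1) \<le> count x (Vert v)"
    by (simp add: x)
  show False
  proof (cases "v = u")
    case True
    have "q_elem G w v (i - 1) \<subseteq># x" by (simp add: x)
    with at_u[of i] i enough True show False by simp
  next
    case False
    have "enat (count x (Vert v)) < min_gap G w v"
      using away[OF \<open>v \<in> verts G\<close> False] gap_pos enough by linarith
    also have "\<dots> \<le> enat (nth_weight G w v i - nth_weight G w v (i - 1))"
      using min_gap_le_gap[OF v i] .
    finally show False using enough by simp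
  qed
qed

section \<open>Competing reductions at one vertex\<close>

text \<open>
  Since \<open>q\<^sub>0 = 0\<close>, the rule for the smallest weight consumes only copies of its vertex, and can
  therefore be iterated whatever the surrounding element \<open>x\<close> is.
\<close>

lemma reductions_first_weight:
  assumes wg: "weighted_graph G w" and u: "is_regular G u"
    and x: "x \<in> free_comm_monoid (gens G w)"
  defines "a \<equiv> nth_weight G w u 1"
  shows "(reduction G w)\<^sup>*\<^sup>* (x + replicate_mset (n * a) (Vert u))
           (x + repeat_mset n (q_elem G w u 1 + range_sum G w a u))"
  using x
proof (induction n arbitrary: x)
  case 0
  then show ?case by simp
next
  case (Suc n)
  interpret weighted_graph G w by fact
  let ?c = "q_elem G w u 1 + range_sum G w a u"
  have k: "1 \<le> num_weights G w u" and u': "u \<in> verts G" "finite (out_arcs G u)"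
    using u by (auto simp: is_regular_def num_weights_def Suc_le_eq card_gt_0_iff)
  have c: "x + ?c \<in> free_comm_monoid (gens G w)"
    using Suc.prems q_elem_in_free_comm_monoid[OF u'(1) k]
      range_sum_in_free_comm_monoid[OF wf_digraph_axioms u'(2)] by simp
  have "x + replicate_mset (n * a) (Vert u) \<in> free_comm_monoid (gens G w)"
    using Suc.prems replicate_Vert_in_free_comm_monoid[OF u'(1)] by simp
  note step = reduction.intros[OF this u order.refl k]
  have "x + replicate_mset (Suc n * a) (Vert u)
      = x + replicate_mset (n * a) (Vert u) + q_elem G w u (1 - 1)
        + replicate_mset (nth_weight G w u 1 - nth_weight G w u (1 - 1)) (Vert u)"
    by (rule multiset_eqI) (simp add: a_def q_elem_def nth_weight_def)
  moreover have "x + ?c + replicate_mset (n * a) (Vert u)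
      = x + replicate_mset (n * a) (Vert u) + q_elem G w u 1
        + range_sum G w (nth_weight G w u 1) u"
    by (simp add: a_def)
  ultimately have "reduction G w (x + replicate_mset (Suc n * a) (Vert u))
      (x + ?c + replicate_mset (n * a) (Vert u))"
    using step by metis
  moreover have "x + ?c + repeat_mset n ?c = x + repeat_mset (Suc n) ?c"
    by simp
  ultimately show ?case
    using Suc.IH[OF c] by (metis converse_rtranclp_into_rtranclp)
qed

theorem proposition3p29:
  fixes G :: "('v, 'e) pre_digraph" and w :: "'e \<Rightarrow> nat"
    and u :: 'v and \<alpha> \<beta> m \<delta> :: nat
  assumes "weighted_graph G w"
    and "u \<in> verts G"
    and "w ` out_arcs G u = {\<alpha>, \<beta>}" and "\<alpha> < \<beta>"
    and "u \<notin> head G ` out_arcs G u"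
    and "\<beta> = m * \<alpha> + \<delta>" and "1 \<le> m" and "\<delta> < \<alpha>"
    and "\<And>s. s \<in> supp0 G (range_sum G w \<alpha> u) \<union> supp0 G (range_sum G w \<beta> u) \<Longrightarrow>
      min_gap G w s > enat
        (if m = 1
         then max (count (range_sum G w \<alpha> u) (Vert s)) (count (range_sum G w \<beta> u) (Vert s))
         else max (count (range_sum G w \<alpha> u) (Vert s) + count (range_sum G w \<beta> u) (Vert s))
                  (m * count (range_sum G w \<alpha> u) (Vert s)))"
  shows "\<not> wgm_confluent G w"
proof -
  interpret weighted_graph G w by fact
  define A where "A = range_sum G w \<alpha> u"
  define B where "B = range_sum G w \<beta> u"
  define q where "q = {#Aux u 1 :: 'v gen#}"
  have fin: "finite (out_arcs G u)" using row_finite[OF assms(2)] .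
  have regular: "is_regular G u"
    using assms(2,3) fin by (auto simp: is_regular_def)
  have k: "num_weights G w u = 2"
    using assms(3,4) by (simp add: num_weights_def)
  have weights: "nth_weight G w u 0 = 0" "nth_weight G w u 1 = \<alpha>" "nth_weight G w u 2 = \<beta>"
      "nth_weight G w u (Suc 0) = \<alpha>"
    using assms(3,4) by (simp_all add: nth_weight_def)
  have q_elems: "q_elem G w u 0 = {#}" "q_elem G w u 1 = q" "q_elem G w u 2 = {#}"
      "q_elem G w u (Suc 0) = q"
    by (simp_all add: q_elem_def k q_def)
  have in_F: "A \<in> free_comm_monoid (gens G w)" "B \<in> free_comm_monoid (gens G w)"
      "q \<in> free_comm_monoid (gens G w)"
      "replicate_mset n (Vert u) \<in> free_comm_monoid (gens G w)" for n
    using range_sum_in_free_comm_monoid[OF wf_digraph_axioms fin]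
      q_elem_in_free_comm_monoid[OF assms(2), of 1 w, unfolded q_elems k]
      replicate_Vert_in_free_comm_monoid[OF assms(2)]
    by (simp_all add: A_def B_def)
  have count_range_sums [simp]: "count A (Vert u) = 0" "count B (Vert u) = 0"
      "count A (Aux v i) = 0" "count B (Aux v i) = 0" for v i
    using set_mset_range_sum[OF fin, of w] assms(5)
    by (fastforce simp: A_def B_def not_in_iff[symmetric])+
  have count_q [simp]: "count q (Vert v) = 0" for v
    by (simp add: q_def)

  have bounds: "enat (m * count A (Vert s)) < min_gap G w s"
      "enat (count B (Vert s)) < min_gap G w s"
      "m \<noteq> 1 \<Longrightarrow> enat (count A (Vert s) + count B (Vert s)) < min_gap G w s"
    if s: "s \<in> verts G" "0 < count A (Vert s) + count B (Vert s)" for s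
  proof -
    have "s \<in> supp0 G A \<union> supp0 G B"
      using s by (auto simp: supp0_def)
    note assms(9)[folded A_def B_def, OF this]
    then show "enat (m * count A (Vert s)) < min_gap G w s"
        "enat (count B (Vert s)) < min_gap G w s"
        "m \<noteq> 1 \<Longrightarrow> enat (count A (Vert s) + count B (Vert s)) < min_gap G w s"
      by (auto split: if_splits elim!: order.strict_trans1[rotated])
  qed

  have irreducible: "\<not> reduction G w x y"
    if "\<And>v. v \<in> verts G \<Longrightarrow> v \<noteq> u \<Longrightarrow> 0 < count x (Vert v) \<Longrightarrow>
          enat (count x (Vert v)) < min_gap G w v"
      and "count x (Vert u) < \<alpha>"
      and "0 < count x (Aux u 1) \<Longrightarrow> count x (Vert u) < \<beta> - \<alpha>" for x y
  proof (rule irreducible_if_below_min_gap[OF assms(1) that(1)])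
    fix i assume "1 \<le> i" "i \<le> num_weights G w u" and sub: "q_elem G w u (i - 1) \<subseteq># x"
    then consider "i = 1" | "i = 2" using k by linarith
    then show "count x (Vert u) < nth_weight G w u i - nth_weight G w u (i - 1)"
    proof cases
      case 1
      then show ?thesis using that(2) by (simp add: weights)
    next
      case 2
      then show ?thesis using that(3) sub by (simp add: weights q_elems q_def)
    qed
  qed

  let ?p = "q + replicate_mset (m * \<alpha>) (Vert u)"
  let ?a = "q + repeat_mset m (q + A)"
  have p: "?p \<in> free_comm_monoid (gens G w)" using in_F by simp
  have p_a: "(reduction G w)\<^sup>*\<^sup>* ?p ?a"
    using reductions_first_weight[OF assms(1) regular in_F(3), of m]
    by (simp add: weights q_elems A_def)
  have a_irreducible: "\<not> reduction G w ?a y" for y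
  proof (rule irreducible)
    fix v assume "v \<in> verts G" "0 < count ?a (Vert v)"
    then show "enat (count ?a (Vert v)) < min_gap G w v"
      using bounds(1)[of v] by simp
  qed (use assms(4,8) in simp_all)

  let ?b = "B + replicate_mset (\<alpha> - \<delta>) (Vert u)"
  have p_b: "reduction G w ?p ?b"
  proof -
    have "?p = replicate_mset (\<alpha> - \<delta>) (Vert u) + q_elem G w u (2 - 1)
        + replicate_mset (nth_weight G w u 2 - nth_weight G w u (2 - 1)) (Vert u)"
      using assms(4,6,8) by (intro multiset_eqI) (simp add: weights q_elems)
    then show ?thesis
      using reduction.intros[OF in_F(4) regular, of 2 "\<alpha> - \<delta>"]
      by (simp add: k weights q_elems B_def ac_simps)
  qed

  show ?thesis
  proof (cases "\<delta> = 0")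
    case False
    have "\<not> reduction G w ?b y" for y
    proof (rule irreducible)
      fix v assume "v \<in> verts G" "v \<noteq> u" "0 < count ?b (Vert v)"
      then show "enat (count ?b (Vert v)) < min_gap G w v"
        using bounds(2)[of v] by simp
    qed (use False assms(8) in simp_all)
    moreover have "count ?a (Aux u 1) \<noteq> count ?b (Aux u 1)"
      by (simp add: q_def)
    ultimately show ?thesis
      using not_confluent_if_two_normal_forms[OF wf_digraph_axioms p p_a a_irreducible] p_b
      by (metis r_into_rtranclp)
  next
    case True
    \<comment> \<open>Both \<open>A\<close> and \<open>B\<close> occur in the second result here, so the bound on
      \<open>c\<^sub>s(A) + c\<^sub>s(B)\<close> is needed; it is assumed only for \<open>m \<noteq> 1\<close>.\<close>
    have "m \<noteq> 1" using True assms(4,6) by auto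
    let ?b' = "B + (q + A)"
    have "(reduction G w)\<^sup>*\<^sup>* ?b ?b'"
      using reductions_first_weight[OF assms(1) regular in_F(2), of 1] True
      by (simp add: weights q_elems A_def)
    then have "(reduction G w)\<^sup>*\<^sup>* ?p ?b'"
      using p_b by (rule converse_rtranclp_into_rtranclp[rotated])
    moreover have "\<not> reduction G w ?b' y" for y
    proof (rule irreducible)
      fix v assume "v \<in> verts G" "0 < count ?b' (Vert v)"
      then show "enat (count ?b' (Vert v)) < min_gap G w v"
        using bounds(3)[of v] \<open>m \<noteq> 1\<close> by (simp add: add.commute)
    qed (use assms(4,8) in simp_all)
    moreover have "count ?a (Aux u 1) \<noteq> count ?b' (Aux u 1)"
      using assms(7) by (simp add: q_def)
    ultimately show ?thesis
      using not_confluent_if_two_normal_forms[OF wf_digraph_axioms p p_a a_irreducible]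
      by metis
  qed
qed

end
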